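(* Let $P$ be an Ising model on $\mathcal{X}(G)$ with pairwise potential of interaction $f$, and let $r=\sup_{i\in G}\sup_{a\in A}\sum_{j\in G}\|f_{i,j}^a\|<\infty$. There exist two positive constants $c_r^*\le C_r^*$ such that, for all $i\in G$ and all subsets $V$ of $G$, $$c_r^*\sum_{j\notin V}\omega_{i,j}(f)\le\left\|P_{i|G}-P_{i|V}\right\|_\infty\le C_r^*\sum_{j\notin V}\omega_{i,j}(f).$$ Moreover, there exists a constant $\kappa_{\min}>0$ such that, for all $i\in G$ and all finite subsets $V$ of $G$, $$\kappa_{\min}\left\|P_{i|G}-P_{i|V}\right\|_\infty\le\left\|P_{i|G}\right\|_\infty-\left\|P_{i|V}\right\|_\infty .$$
   Context: $G$ is a discrete set of sites (possibly infinite), $A=\{-1,1\}$, and for $V\subset G$, $\mathcal{X}(V)=A^V$. For $x\in\mathcal{X}(G)$ write $x(V)=(x(j))_{j\in V}$, and let $x_i$ be the configuration equal to $x$ except at $i$, where $x_i(i)=-x(i)$. $P_{i|V}(x)=P(x(i)\mid x(V\setminus\{i\}))$ is a regular version of the conditional probability that the spin at $i$ equals $x(i)$ given that the configuration on $V\setminus\{i\}$ is $x(V\setminus\{i\})$. $\|h\|_\infty=\sup_{x\in\mathcal{X}(G)}|h(x)|$. A function $f:G^2\times A^2\to\mathbb{R}$, $(i,j,a,b)\mapsto f_{i,j}(a,b)$, is a pairwise potential of interaction if $f_{i,i}(a,b)=0$ for all $i\in G$, $a,b\in A$, and $r:=\sup_{i\in G}\sup_{a\in A}\sum_{j\in G}\|f_{i,j}^a\|<\infty$,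 where $\|f_{i,j}^a\|=\max_{b\in A}|f_{i,j}(a,b)|$. A probability measure $P$ on $\mathcal{X}(G)$ is an Ising model with potential $f$ if, for all $i\in G$ and all $x\in\mathcal{X}(G)$, $$P_{i|G}(x)=\frac{e^{\sum_{j\in G}f_{i,j}(x(i),x(j))}}{\sum_{a\in A}e^{\sum_{j\in G}f_{i,j}(a,x(j))}} .$$ Let $g_{i,j}(a,b)=f_{i,j}(a,b)-f_{i,j}(-a,b)$ and $\omega_{i,j}(f)=\sup_{(a,b)\in A^2}\{g_{i,j}(a,b)-g_{i,j}(a,-b)\}$. The subscript $r$ in $c_r^*,C_r^*$ indicates constants depending on $r$.
   Formalization: For infinite V the upper bound is stated for a suitable choice of the regular versions P_{i|V}, since changing a version on a null set can make it fail (e.g. f = 0); for finite V, and for the lower bound, every choice of versions is covered. *)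

theory Defs
  imports "HOL-Probability.Probability"
begin

text \<open>Spins take values in \<open>A = {-1, 1}\<close>; the sites form an arbitrary set \<open>G\<close>, with no
  countability assumption. The space of the product \<open>config_space V\<close> is the set
  \<open>config V\<close> of extensional functions on \<open>V\<close>.\<close>

definition spins :: "int set" where
  "spins = {-1, 1}"

definition config :: "'g set \<Rightarrow> ('g \<Rightarrow> int) set" where
  "config V = (\<Pi>\<^sub>E j\<in>V. spins)"

definition config_space :: "'g set \<Rightarrow> ('g \<Rightarrow> int) measure" where
  "config_space V = (\<Pi>\<^sub>M j\<in>V. count_space spins)"

definition sup_norm :: "'g set \<Rightarrow> (('g \<Rightarrow> int) \<Rightarrow> real) \<Rightarrow> real" where
  "sup_norm G h = (SUP x\<in>config G. \<bar>h x\<bar>)"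

text \<open>A potential is a function \<open>f i j a b\<close>. Its strength \<open>r\<close> is computed in the extended
  nonnegative reals, so that finiteness includes summability.\<close>

type_synonym 'g potential = "'g \<Rightarrow> 'g \<Rightarrow> int \<Rightarrow> int \<Rightarrow> real"

definition potential_norm :: "'g potential \<Rightarrow> 'g \<Rightarrow> 'g \<Rightarrow> int \<Rightarrow> real" where
  "potential_norm f i j a = Max ((\<lambda>b. \<bar>f i j a b\<bar>) ` spins)"

definition strength :: "'g set \<Rightarrow> 'g potential \<Rightarrow> ennreal" where
  "strength G f = (SUP i\<in>G. SUP a\<in>spins. \<Sum>\<^sub>\<infinity>j\<in>G. ennreal (potential_norm f i j a))"

definition pairwise_potential :: "'g set \<Rightarrow> 'g potential \<Rightarrow> bool" where
  "pairwise_potential G f \<longleftrightarrow>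
     (\<forall>i\<in>G. \<forall>a\<in>spins. \<forall>b\<in>spins. f i i a b = 0) \<and> strength G f < \<infinity>"

definition flip_diff :: "'g potential \<Rightarrow> 'g potential" where
  "flip_diff f i j a b = f i j a b - f i j (-a) b"

definition omega :: "'g potential \<Rightarrow> 'g \<Rightarrow> 'g \<Rightarrow> real" where
  "omega f i j = (SUP (a, b)\<in>spins \<times> spins. flip_diff f i j a b - flip_diff f i j a (-b))"

text \<open>The sigma-algebra generated by the configuration on \<open>W\<close>, as a measure space on the
  configurations on \<open>G\<close>.\<close>

definition sigma_config :: "'g set \<Rightarrow> 'g set \<Rightarrow> ('g \<Rightarrow> int) measure" where
  "sigma_config G W = vimage_algebra (config G) (\<lambda>x. restrict x W) (config_space W)"

text \<open>\<open>K\<close> is a regular version of the conditional distribution of the spin at \<open>i\<close> given the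
  configuration on \<open>V - {i}\<close>: a probability kernel from the configurations on \<open>V - {i}\<close> to the
  spins, almost surely equal to the conditional expectation of the events \<open>{y. y i = a}\<close>.
  The site \<open>i\<close> need not belong to \<open>V\<close>.\<close>

definition regular_version ::
  "'g set \<Rightarrow> ('g \<Rightarrow> int) measure \<Rightarrow> 'g \<Rightarrow> 'g set \<Rightarrow> (('g \<Rightarrow> int) \<Rightarrow> int measure) \<Rightarrow> bool" where
  "regular_version G P i V K \<longleftrightarrow>
     K \<in> config_space (V - {i}) \<rightarrow>\<^sub>M prob_algebra (count_space spins) \<and>
     (\<forall>a\<in>spins. AE x in P. measure (K (restrict x (V - {i}))) {a} =
        real_cond_exp P (sigma_config G (V - {i})) (indicator {y \<in> config G. y i = a}) x)"

text \<open>The function \<open>x \<mapsto> P(x(i) | x(V - {i}))\<close> determined by the version \<open>K\<close>.\<close>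

definition cond_spin :: "'g \<Rightarrow> 'g set \<Rightarrow> (('g \<Rightarrow> int) \<Rightarrow> int measure) \<Rightarrow> ('g \<Rightarrow> int) \<Rightarrow> real" where
  "cond_spin i V K x = measure (K (restrict x (V - {i}))) {x i}"

definition ising_prob :: "'g set \<Rightarrow> 'g potential \<Rightarrow> 'g \<Rightarrow> ('g \<Rightarrow> int) \<Rightarrow> real" where
  "ising_prob G f i x =
     exp (\<Sum>\<^sub>\<infinity>j\<in>G. f i j (x i) (x j)) / (\<Sum>a\<in>spins. exp (\<Sum>\<^sub>\<infinity>j\<in>G. f i j a (x j)))"

text \<open>Conditional probabilities are only determined almost surely, so that the identity defining
  an Ising model, required at every configuration, is to be read as: the Ising formula is a regular
  version of the conditional probability.\<close>

definition ising_model :: "'g set \<Rightarrow> 'g potential \<Rightarrow> ('g \<Rightarrow> int) measure \<Rightarrow> bool" where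
  "ising_model G f P \<longleftrightarrow>
     prob_space P \<and> sets P = sets (config_space G) \<and>
     (\<forall>i\<in>G. \<exists>K. regular_version G P i G K \<and>
        (\<forall>x\<in>config G. cond_spin i G K x = ising_prob G f i x))"

text \<open>A choice \<open>Q i V\<close> of regular versions of all the conditional probabilities, where the one
  given the whole configuration is the version singled out by the definition of an Ising model.\<close>

definition ising_versions ::
  "'g set \<Rightarrow> 'g potential \<Rightarrow> ('g \<Rightarrow> int) measure \<Rightarrow>
   ('g \<Rightarrow> 'g set \<Rightarrow> ('g \<Rightarrow> int) \<Rightarrow> int measure) \<Rightarrow> bool" where
  "ising_versions G f P Q \<longleftrightarrow>
     (\<forall>i\<in>G. \<forall>V\<subseteq>G. regular_version G P i V (Q i V)) \<and>
     (\<forall>i\<in>G. \<forall>x\<in>config G. cond_spin i G (Q i G) x = ising_prob G f i x)"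

text \<open>The uniform distance between the conditional probabilities given \<open>G\<close> and given \<open>V\<close>.\<close>

definition cond_dist ::
  "'g set \<Rightarrow> ('g \<Rightarrow> 'g set \<Rightarrow> ('g \<Rightarrow> int) \<Rightarrow> int measure) \<Rightarrow> 'g \<Rightarrow> 'g set \<Rightarrow> real" where
  "cond_dist G Q i V = sup_norm G (\<lambda>x. cond_spin i G (Q i G) x - cond_spin i V (Q i V) x)"

end

theory Submission
  imports Defs
begin

text \<open>Flipping the spin at \<open>i\<close> changes the energy by the gap
  \<open>S a x = (\<Sum>j. g i j a (x j))\<close>, where \<open>g = flip_diff f\<close>, and the Ising formula says that the spin at
  \<open>i\<close> equals \<open>a\<close> with conditional probability \<open>q a x = \<sigma> (S a x)\<close>, where \<open>\<sigma>\<close> is the logistic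
  function. As \<open>\<bar>S\<bar> \<le> 2 * r\<close>, all these probabilities are at least \<open>p = \<sigma> (- 2 * r)\<close>, and on the
  range of \<open>S\<close> the slope of \<open>\<sigma>\<close> lies between \<open>p\<^sup>2\<close> and \<open>1\<close>.

  Two configurations that agree on \<open>V\<close> have gaps that differ by at most
  \<open>\<Omega> = (\<Sum>j\<in>G - V. \<omega> i j)\<close>, and this value is attained: set every spin outside \<open>V\<close> to the value that
  makes \<open>S\<close> largest, respectively smallest (\<open>gap_best_minus_worst\<close>). The three estimates follow.

  Lower bound. A conditional probability given \<open>V\<close> takes the same value at these two extremal
  configurations, but \<open>q\<close> differs there by at least \<open>p\<^sup>2 * \<Omega>\<close>. So one of the two is at distance at
  least \<open>p\<^sup>2 * \<Omega> / 2\<close>, whatever version is chosen (\<open>omega_le_cond_dist\<close>).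

  Upper bound. A conditional probability given \<open>V\<close> is an average of \<open>q\<close> over the unknown spins, so it
  lies between the two extremal values of \<open>q\<close>, which are at most \<open>\<Omega>\<close> apart. For finite \<open>V\<close> every
  configuration on \<open>V\<close> has positive probability, so that this holds everywhere. For infinite \<open>V\<close> it
  holds almost surely, and truncating an arbitrary version at the extremal values
  gives a version for which it holds everywhere (\<open>enclosed_version_exists\<close>).

  Gain in supremum norm. Averaging also loses a definite amount: each spin \<open>j\<close> outside \<open>V\<close> takes the
  value that does not favour \<open>a\<close> with conditional probability at least \<open>p\<close>, which lowers \<open>S\<close> by
  \<open>\<omega> i j\<close> and hence \<open>q\<close> by a slope of at least \<open>p\<^sup>2\<close>. Thus a conditional probability given a finite
  \<open>V\<close> is below the largest value of \<open>q\<close> by at least \<open>p ^ 3 * \<Omega>\<close> (\<open>version_le_best_minus\<close>).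

  The constants are therefore \<open>c = p\<^sup>2 / 2\<close>, \<open>C = 1\<close> and \<open>\<kappa> = p ^ 3\<close>.\<close>

section \<open>The logistic function\<close>

definition logistic :: "real \<Rightarrow> real" where
  "logistic u = 1 / (1 + exp (- u))"

lemma logistic_pos: "0 < logistic u"
  by (simp add: logistic_def add_pos_pos)

lemma logistic_le_1: "logistic u \<le> 1"
  by (simp add: logistic_def add_pos_pos)

lemma logistic_minus: "logistic (- u) = 1 - logistic u"
proof -
  have "1 + exp u \<noteq> 0" "1 + exp (- u) \<noteq> 0"
    by (smt (verit) exp_gt_zero)+
  then show ?thesis
    by (simp add: logistic_def field_simps flip: exp_add)
qed

lemma logistic_mono: "u \<le> v \<Longrightarrow> logistic u \<le> logistic v"
  by (simp add: logistic_def frac_le add_pos_pos)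

lemma logistic_deriv:
  "(logistic has_real_derivative logistic u * logistic (- u)) (at u)"
proof -
  have "1 + exp (- u) \<noteq> 0"
    by (smt (verit) exp_gt_zero)
  then have "(logistic has_real_derivative exp (- u) / (1 + exp (- u))\<^sup>2) (at u)"
    unfolding logistic_def [abs_def]
    by (auto intro!: derivative_eq_intros simp: power2_eq_square)
  moreover have "exp (- u) / (1 + exp (- u))\<^sup>2 = logistic u * (1 - logistic u)"
    using \<open>1 + exp (- u) \<noteq> 0\<close>
    by (simp add: logistic_def power2_eq_square divide_simps)
  ultimately show ?thesis
    by (simp add: logistic_minus)
qed

lemma logistic_mean_value:
  assumes "v \<le> u"
  obtains t where "v \<le> t" "t \<le> u"
    "logistic u - logistic v = (u - v) * (logistic t * logistic (- t))"
proof (cases "v = u")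
  case False
  with assms have "v < u" by simp
  from MVT2 [OF this logistic_deriv] show ?thesis
    by (metis less_imp_le that)
qed (use that in auto)

lemma logistic_diff_le:
  assumes "v \<le> u"
  shows "logistic u - logistic v \<le> u - v"
proof -
  obtain t where t: "logistic u - logistic v = (u - v) * (logistic t * logistic (- t))"
    using logistic_mean_value [OF assms] by blast
  have "logistic t * logistic (- t) \<le> 1"
    by (simp add: mult_le_one logistic_le_1 logistic_pos less_imp_le)
  then show ?thesis
    unfolding t using assms by (simp add: mult_left_le)
qed

text \<open>The derivative \<open>logistic t * logistic (- t)\<close> is a product of two values that, for
  \<open>\<bar>t\<bar> \<le> R\<close>, are both at least \<open>logistic (- R)\<close>.\<close>

lemma logistic_diff_ge:
  assumes "v \<le> u" "\<bar>u\<bar> \<le> R" "\<bar>v\<bar> \<le> R"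
  shows "(logistic (- R))\<^sup>2 * (u - v) \<le> logistic u - logistic v"
proof -
  obtain t where t: "v \<le> t" "t \<le> u"
    "logistic u - logistic v = (u - v) * (logistic t * logistic (- t))"
    using logistic_mean_value [OF assms(1)] by blast
  have "(logistic (- R))\<^sup>2 \<le> logistic t * logistic (- t)"
    unfolding power2_eq_square
    using t assms by (intro mult_mono logistic_mono) (auto simp: logistic_pos less_imp_le)
  then show ?thesis
    unfolding t(3) using assms(1) by (metis diff_ge_0_iff_ge mult.commute mult_left_mono)
qed

section \<open>Differences of unconditional sums\<close>

lemma summable_on_minus:
  fixes h k :: "'b \<Rightarrow> real"
  assumes "h summable_on A" "k summable_on A"
  shows "(\<lambda>j. h j - k j) summable_on A"
  using summable_on_add [OF assms(1), of "\<lambda>j. - k j"] assms(2) by (simp add: summable_on_uminus)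

lemma infsum_minus:
  fixes h k :: "'b \<Rightarrow> real"
  assumes "h summable_on A" "k summable_on A"
  shows "(\<Sum>\<^sub>\<infinity>j\<in>A. h j - k j) = infsum h A - infsum k A"
  using infsum_add [OF assms(1), of "\<lambda>j. - k j"] assms(2)
  by (simp add: summable_on_uminus infsum_uminus)

section \<open>The energy gap of a pairwise potential\<close>

lemma finite_spins [simp]: "finite spins"
  and spins_nonempty [simp]: "spins \<noteq> {}"
  and uminus_in_spins [simp]: "- a \<in> spins \<longleftrightarrow> a \<in> spins"
  and one_in_spins [simp]: "1 \<in> spins"
  by (auto simp: spins_def)

lemma in_configD: "x \<in> config V \<Longrightarrow> j \<in> V \<Longrightarrow> x j \<in> spins"
  by (auto simp: config_def)

lemma config_update: "x \<in> config V \<Longrightarrow> i \<in> V \<Longrightarrow> a \<in> spins \<Longrightarrow> x(i := a) \<in> config V"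
  by (auto simp: config_def PiE_iff extensional_def)

definition gap :: "'g set \<Rightarrow> 'g potential \<Rightarrow> 'g \<Rightarrow> int \<Rightarrow> ('g \<Rightarrow> int) \<Rightarrow> real" where
  "gap G f i a x = (\<Sum>\<^sub>\<infinity>j\<in>G. flip_diff f i j a (x j))"

text \<open>The configuration \<open>x\<close> is kept on \<open>W\<close> and replaced by \<open>t\<close> elsewhere. This serves both to build the
  extremal configurations and, with a constant \<open>t\<close>, to extend configurations from \<open>W\<close> to \<open>G\<close>.\<close>

definition patch :: "'g set \<Rightarrow> 'g set \<Rightarrow> ('g \<Rightarrow> int) \<Rightarrow> ('g \<Rightarrow> int) \<Rightarrow> 'g \<Rightarrow> int" where
  "patch G W t x = (\<lambda>j\<in>G. if j \<in> W then x j else t j)"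

text \<open>The value of the spin at \<open>j\<close> that maximises \<open>flip_diff f i j a\<close>. The factor \<open>a\<close> makes it odd in
  \<open>a\<close> even when both values are maximal, so that \<open>favourable f i (- a)\<close> is always the least
  favourable choice for \<open>a\<close>.\<close>

definition favourable :: "'g potential \<Rightarrow> 'g \<Rightarrow> int \<Rightarrow> 'g \<Rightarrow> int" where
  "favourable f i a j = a * (if flip_diff f i j 1 (-1) \<le> flip_diff f i j 1 1 then 1 else -1)"

lemma favourable_in_spins [simp]: "a \<in> spins \<Longrightarrow> favourable f i a j \<in> spins"
  by (auto simp: favourable_def spins_def)

lemma favourable_minus: "favourable f i (- a) j = - favourable f i a j"
  by (simp add: favourable_def)

lemma patch_in_config:
  assumes "\<And>j. j \<in> W \<Longrightarrow> j \<in> G \<Longrightarrow> x j \<in> spins" "\<And>j. j \<in> G \<Longrightarrow> t j \<in> spins"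
  shows "patch G W t x \<in> config G"
  using assms by (auto simp: patch_def config_def)

lemma restrict_patch: "W \<subseteq> G \<Longrightarrow> restrict (patch G W t x) W = restrict x W"
  by (auto simp: patch_def restrict_def fun_eq_iff)

lemma patch_self: "x \<in> config G \<Longrightarrow> patch G W x x = x"
  by (auto simp: patch_def config_def PiE_iff extensional_def fun_eq_iff)

lemma flip_diff_minus: "flip_diff f i j (- a) b = - flip_diff f i j a b"
  by (simp add: flip_diff_def)

text \<open>As \<open>flip_diff f i j\<close> is odd in \<open>a\<close>, the four differences in the supremum are, up to sign, the same
  number; choosing the favourable spin makes it nonnegative.\<close>

lemma omega_eq_favourable:
  assumes "a \<in> spins"
  shows "omega f i j =
    flip_diff f i j a (favourable f i a j) - flip_diff f i j a (- favourable f i a j)"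
proof -
  have "spins \<times> spins = {(1, 1), (1, -1), (-1, 1), (-1, -1)}"
    by (auto simp: spins_def)
  then have "omega f i j = \<bar>flip_diff f i j 1 1 - flip_diff f i j 1 (-1)\<bar>"
    unfolding omega_def
    by (simp add: cSup_eq_Max flip_diff_minus [of _ _ _ 1, simplified] abs_if max_def)
  then show ?thesis
    using assms flip_diff_minus [of f i j 1]
    by (auto simp: favourable_def spins_def abs_if)
qed

lemma omega_nonneg: "0 \<le> omega f i j"
  by (simp add: omega_eq_favourable [of 1] favourable_def)

lemma flip_diff_favourable:
  assumes "a \<in> spins" "b \<in> spins"
  shows "flip_diff f i j a (favourable f i a j) - flip_diff f i j a b =
    (if b = favourable f i a j then 0 else omega f i j)"
  using assms omega_eq_favourable [OF assms(1), of f i j] favourable_in_spins [OF assms(1), of f i j]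
  by (auto simp: spins_def)

lemma flip_diff_le_favourable:
  assumes "a \<in> spins" "b \<in> spins"
  shows "flip_diff f i j a b \<le> flip_diff f i j a (favourable f i a j)"
  using flip_diff_favourable [OF assms, of f i j] omega_nonneg [of f i j] by (auto split: if_splits)

locale bounded_potential =
  fixes G :: "'g set" and f :: "'g potential" and r :: real
  assumes potential: "pairwise_potential G f"
    and strength: "strength G f = ennreal r"
    and strength_nonneg: "0 \<le> r"
begin

lemma abs_le_potential_norm: "b \<in> spins \<Longrightarrow> \<bar>f i j a b\<bar> \<le> potential_norm f i j a"
  by (simp add: potential_norm_def)

lemma potential_norm_nonneg: "0 \<le> potential_norm f i j a"
  using abs_le_potential_norm [of 1 i j a] by simp

lemma finite_sum_potential_norm_le:
  assumes "i \<in> G" "a \<in> spins" "finite F" "F \<subseteq> G"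
  shows "(\<Sum>j\<in>F. potential_norm f i j a) \<le> r"
proof -
  let ?h = "\<lambda>j. ennreal (potential_norm f i j a)"
  have "ennreal (\<Sum>j\<in>F. potential_norm f i j a) = (\<Sum>j\<in>F. ?h j)"
    by (simp add: potential_norm_nonneg)
  also have "\<dots> \<le> (\<Sum>\<^sub>\<infinity>j\<in>G. ?h j)"
    using assms by (subst nonneg_infsum_complete) (auto intro!: SUP_upper)
  also have "\<dots> \<le> strength G f"
    unfolding strength_def using assms by (auto intro!: SUP_upper2)
  finally show ?thesis
    using strength strength_nonneg by simp
qed

lemma potential_norm_summable:
  assumes "i \<in> G" "a \<in> spins"
  shows "(\<lambda>j. potential_norm f i j a) summable_on G"
  by (rule nonneg_bdd_above_summable_on)
    (use finite_sum_potential_norm_le [OF assms] in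
      \<open>auto simp: potential_norm_nonneg intro!: bdd_aboveI2\<close>)

lemma infsum_potential_norm_le:
  assumes "i \<in> G" "a \<in> spins"
  shows "(\<Sum>\<^sub>\<infinity>j\<in>G. potential_norm f i j a) \<le> r"
  using potential_norm_summable [OF assms] finite_sum_potential_norm_le [OF assms]
  by (rule infsum_le_finite_sums)

lemma potential_summable:
  assumes "i \<in> G" "a \<in> spins" "\<And>j. j \<in> G \<Longrightarrow> t j \<in> spins"
  shows "(\<lambda>j. f i j a (t j)) summable_on G"
    and "\<bar>\<Sum>\<^sub>\<infinity>j\<in>G. f i j a (t j)\<bar> \<le> r"
proof -
  have abs: "(\<lambda>j. norm (f i j a (t j))) summable_on G"
    using potential_norm_summable [OF assms(1,2)]
    by (rule Infinite_Sum.abs_summable_on_comparison_test') (simp add: abs_le_potential_norm assms)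
  then show "(\<lambda>j. f i j a (t j)) summable_on G"
    by (rule abs_summable_summable)
  have "\<bar>\<Sum>\<^sub>\<infinity>j\<in>G. f i j a (t j)\<bar> \<le> (\<Sum>\<^sub>\<infinity>j\<in>G. norm (f i j a (t j)))"
    using norm_infsum_bound [OF abs] by simp
  also have "\<dots> \<le> (\<Sum>\<^sub>\<infinity>j\<in>G. potential_norm f i j a)"
    using abs potential_norm_summable [OF assms(1,2)]
    by (rule infsum_mono) (simp add: abs_le_potential_norm assms)
  finally show "\<bar>\<Sum>\<^sub>\<infinity>j\<in>G. f i j a (t j)\<bar> \<le> r"
    using infsum_potential_norm_le [OF assms(1,2)] by linarith
qed

lemma flip_diff_summable:
  assumes "i \<in> G" "a \<in> spins" "\<And>j. j \<in> G \<Longrightarrow> t j \<in> spins" "S \<subseteq> G"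
  shows "(\<lambda>j. flip_diff f i j a (t j)) summable_on S"
proof -
  have "(\<lambda>j. flip_diff f i j a (t j)) summable_on G"
    unfolding flip_diff_def using assms by (intro summable_on_minus potential_summable) auto
  then show ?thesis
    using \<open>S \<subseteq> G\<close> by (rule summable_on_subset_banach)
qed

lemma gap_eq:
  assumes "i \<in> G" "a \<in> spins" "x \<in> config G"
  shows "gap G f i a x = (\<Sum>\<^sub>\<infinity>j\<in>G. f i j a (x j)) - (\<Sum>\<^sub>\<infinity>j\<in>G. f i j (- a) (x j))"
  unfolding gap_def flip_diff_def
  by (rule infsum_minus) (use assms in \<open>auto intro!: potential_summable dest: in_configD\<close>)

lemma abs_gap_le:
  assumes "i \<in> G" "a \<in> spins" "x \<in> config G"
  shows "\<bar>gap G f i a x\<bar> \<le> 2 * r"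
  unfolding gap_eq [OF assms]
  using potential_summable(2) [OF assms(1,2), of x] potential_summable(2) [of i "- a" x] assms
  by (fastforce dest: in_configD)

lemma gap_minus: "gap G f i (- a) x = - gap G f i a x"
  by (simp add: gap_def flip_diff_minus infsum_uminus)

lemma flip_diff_self: "i \<in> G \<Longrightarrow> a \<in> spins \<Longrightarrow> b \<in> spins \<Longrightarrow> flip_diff f i i a b = 0"
  using potential by (simp add: pairwise_potential_def flip_diff_def)

text \<open>The spin at \<open>i\<close> does not interact with itself, so the gap at \<open>i\<close> depends only on the other spins.\<close>

lemma gap_update:
  assumes "i \<in> G" "a \<in> spins" "x \<in> config G" "b \<in> spins"
  shows "gap G f i a (x(i := b)) = gap G f i a x"
  unfolding gap_def
  using assms by (intro infsum_cong) (auto simp: flip_diff_self in_configD)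

lemma ising_prob_eq_logistic:
  assumes "i \<in> G" "x \<in> config G"
  shows "ising_prob G f i x = logistic (gap G f i (x i) x)"
proof -
  define E where "E a = (\<Sum>\<^sub>\<infinity>j\<in>G. f i j a (x j))" for a
  have xi: "x i \<in> spins"
    using assms by (auto dest: in_configD)
  have "ising_prob G f i x = exp (E (x i)) / (exp (E (x i)) + exp (E (- x i)))"
    using xi by (auto simp: ising_prob_def E_def spins_def)
  also have "\<dots> = logistic (E (x i) - E (- x i))"
    by (simp add: logistic_def exp_diff exp_minus field_simps add_pos_pos)
  also have "E (x i) - E (- x i) = gap G f i (x i) x"
    using gap_eq [OF assms(1) xi assms(2)] by (simp add: E_def)
  finally show ?thesis .
qed

lemma omega_summable:
  assumes "i \<in> G" "S \<subseteq> G"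
  shows "(\<lambda>j. omega f i j) summable_on S"
  unfolding omega_eq_favourable [of 1, simplified]
  using assms by (intro summable_on_minus flip_diff_summable) auto

lemma omega_self: "i \<in> G \<Longrightarrow> omega f i i = 0"
  by (simp add: omega_eq_favourable [of 1] flip_diff_self)

text \<open>A conditional probability of the spin at \<open>i\<close> given \<open>V\<close> only uses \<open>V - {i}\<close>. Passing to
  \<open>V - {i}\<close> does not change the neglected interaction, since \<open>f i i\<close> vanishes.\<close>

lemma infsum_omega_remove:
  assumes "i \<in> G"
  shows "(\<Sum>\<^sub>\<infinity>j\<in>G - (V - {i}). omega f i j) = (\<Sum>\<^sub>\<infinity>j\<in>G - V. omega f i j)"
  using omega_self [OF assms] by (intro infsum_cong_neutral) auto

lemma gap_patch_diff:
  assumes "i \<in> G" "a \<in> spins" "x \<in> config G"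
    and "\<And>j. j \<in> G \<Longrightarrow> t j \<in> spins" "\<And>j. j \<in> G \<Longrightarrow> u j \<in> spins"
  shows "gap G f i a (patch G W t x) - gap G f i a (patch G W u x) =
    (\<Sum>\<^sub>\<infinity>j\<in>G - W. flip_diff f i j a (t j) - flip_diff f i j a (u j))"
proof -
  have *: "patch G W s x \<in> config G" if "\<And>j. j \<in> G \<Longrightarrow> s j \<in> spins" for s
    using that assms(3) by (intro patch_in_config) (auto dest: in_configD)
  have "gap G f i a (patch G W t x) - gap G f i a (patch G W u x) =
      (\<Sum>\<^sub>\<infinity>j\<in>G. flip_diff f i j a (patch G W t x j) - flip_diff f i j a (patch G W u x j))"
    unfolding gap_def
    by (rule infsum_minus [symmetric])
      (use * assms in \<open>auto intro!: flip_diff_summable dest: in_configD\<close>)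
  also have "\<dots> = (\<Sum>\<^sub>\<infinity>j\<in>G - W. flip_diff f i j a (t j) - flip_diff f i j a (u j))"
    by (rule infsum_cong_neutral) (auto simp: patch_def)
  finally show ?thesis .
qed

text \<open>Among the configurations that agree with \<open>x\<close> on \<open>W\<close>, this one has the largest gap for \<open>a\<close>.
  By oddness, \<open>best i W (- a) x\<close> is the one with the smallest gap for \<open>a\<close>.\<close>

definition best :: "'g \<Rightarrow> 'g set \<Rightarrow> int \<Rightarrow> ('g \<Rightarrow> int) \<Rightarrow> 'g \<Rightarrow> int" where
  "best i W a x = patch G W (favourable f i a) x"

lemma best_in_config: "a \<in> spins \<Longrightarrow> x \<in> config G \<Longrightarrow> best i W a x \<in> config G"
  unfolding best_def by (auto intro!: patch_in_config dest: in_configD)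

lemma gap_best_minus_worst:
  assumes "i \<in> G" "a \<in> spins" "x \<in> config G"
  shows "gap G f i a (best i W a x) - gap G f i a (best i W (- a) x) = (\<Sum>\<^sub>\<infinity>j\<in>G - W. omega f i j)"
proof -
  have "gap G f i a (best i W a x) - gap G f i a (best i W (- a) x) = (\<Sum>\<^sub>\<infinity>j\<in>G - W.
      flip_diff f i j a (favourable f i a j) - flip_diff f i j a (favourable f i (- a) j))"
    unfolding best_def by (rule gap_patch_diff) (use assms in simp_all)
  also have "\<dots> = (\<Sum>\<^sub>\<infinity>j\<in>G - W. omega f i j)"
    by (rule infsum_cong) (simp only: favourable_minus omega_eq_favourable [OF assms(2)])
  finally show ?thesis .
qed

text \<open>Every unfavourable spin outside \<open>W\<close> costs its full \<open>\<omega>\<close>. The bound is stated for finitely many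
  sites, so that it can be integrated term by term in \<open>version_le_best_minus\<close>.\<close>

lemma gap_best_minus_ge:
  assumes "i \<in> G" "a \<in> spins" "x \<in> config G" "finite F" "F \<subseteq> G - W"
  shows "(\<Sum>j\<in>F. omega f i j * of_bool (x j = - favourable f i a j)) \<le>
    gap G f i a (best i W a x) - gap G f i a x"
proof -
  let ?d = "\<lambda>j. flip_diff f i j a (favourable f i a j) - flip_diff f i j a (x j)"
  have x: "x j \<in> spins" if "j \<in> G" for j
    using that assms by (auto dest: in_configD)
  have "(\<Sum>j\<in>F. omega f i j * of_bool (x j = - favourable f i a j)) = (\<Sum>j\<in>F. ?d j)"
  proof (rule sum.cong)
    fix j assume "j \<in> F"
    then have "x j \<in> spins" using assms x by auto
    with flip_diff_favourable [OF assms(2) this, of f i j] favourable_in_spins [OF assms(2), of f i j]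
    show "omega f i j * of_bool (x j = - favourable f i a j) = ?d j"
      by (auto simp: spins_def)
  qed simp
  also have "\<dots> \<le> (\<Sum>\<^sub>\<infinity>j\<in>G - W. ?d j)"
    by (rule finite_sum_le_infsum)
      (use assms x in \<open>auto intro!: summable_on_minus flip_diff_summable flip_diff_le_favourable\<close>)
  also have "\<dots> = gap G f i a (best i W a x) - gap G f i a (patch G W x x)"
    unfolding best_def using assms x by (subst gap_patch_diff) auto
  also have "patch G W x x = x"
    using assms by (simp add: patch_self)
  finally show ?thesis .
qed

lemma gap_le_best:
  assumes "i \<in> G" "a \<in> spins" "x \<in> config G"
  shows "gap G f i a x \<le> gap G f i a (best i W a x)"
  using gap_best_minus_ge [OF assms, of "{}" W] by simp

lemma gap_best_minus_le:
  assumes "i \<in> G" "a \<in> spins" "x \<in> config G"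
  shows "gap G f i a (best i W (- a) x) \<le> gap G f i a x"
  using gap_le_best [of i "- a" x W] assms by (simp add: gap_minus)

lemma logistic_best_minus_worst:
  assumes "i \<in> G" "a \<in> spins" "x \<in> config G"
  shows "logistic (gap G f i a (best i W a x)) - logistic (gap G f i a (best i W (- a) x))
    \<le> (\<Sum>\<^sub>\<infinity>j\<in>G - W. omega f i j)"
  using logistic_diff_le [of "gap G f i a (best i W (- a) x)" "gap G f i a (best i W a x)"]
    gap_best_minus_worst [OF assms, of W] gap_le_best [OF assms, of W] gap_best_minus_le [OF assms, of W]
  by linarith

end

section \<open>Conditional probabilities of a random configuration\<close>

lemma space_config_space: "space (config_space V) = config V"
  by (simp add: config_space_def config_def space_PiM)

lemma space_sigma_config [simp]: "space (sigma_config G W) = config G"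
  by (simp add: sigma_config_def)

lemma restrict_config: "x \<in> config G \<Longrightarrow> W \<subseteq> G \<Longrightarrow> restrict x W \<in> config W"
  by (auto simp: config_def)

lemma config_nonempty: "config G \<noteq> {}"
  by (simp add: config_def PiE_eq_empty_iff)

lemma restrict_measurable_sigma_config:
  "W \<subseteq> G \<Longrightarrow> (\<lambda>x. restrict x W) \<in> sigma_config G W \<rightarrow>\<^sub>M config_space W"
  unfolding sigma_config_def
  by (rule measurable_vimage_algebra1) (auto simp: space_config_space restrict_config)

lemma restrict_measurable_config_space:
  "W \<subseteq> G \<Longrightarrow> (\<lambda>x. restrict x W) \<in> config_space G \<rightarrow>\<^sub>M config_space W"
  unfolding config_space_def by (rule measurable_restrict_subset)

lemma sigma_config_mono:
  assumes "W \<subseteq> W'" "W' \<subseteq> G"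
  shows "sets (sigma_config G W) \<subseteq> sets (sigma_config G W')"
  unfolding sigma_config_def [of G W]
proof (rule sets_image_in_sets)
  have "(\<lambda>x. restrict (restrict x W') W) \<in> sigma_config G W' \<rightarrow>\<^sub>M config_space W"
    using measurable_compose [OF restrict_measurable_sigma_config [OF assms(2)]
        restrict_measurable_config_space [OF assms(1)]] .
  then show "(\<lambda>x. restrict x W) \<in> sigma_config G W' \<rightarrow>\<^sub>M config_space W"
    using assms by (simp add: Int_absorb1)
qed simp

lemma patch_measurable_config_space:
  assumes "W \<subseteq> G" "\<And>j. j \<in> G \<Longrightarrow> t j \<in> spins"
  shows "patch G W t \<in> config_space W \<rightarrow>\<^sub>M config_space G"
  unfolding config_space_def patch_def [abs_def]
proof (rule measurable_restrict)
  fix j assume "j \<in> G"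
  then show "(\<lambda>x. if j \<in> W then x j else t j) \<in> Pi\<^sub>M W (\<lambda>j. count_space spins) \<rightarrow>\<^sub>M count_space spins"
    using assms by (cases "j \<in> W") (auto intro: measurable_component_singleton)
qed

lemma patch_restrict: "patch G W t (restrict x W) = patch G W t x"
  by (auto simp: patch_def fun_eq_iff)

lemma patch_measurable_sigma_config:
  assumes "W \<subseteq> G" "\<And>j. j \<in> G \<Longrightarrow> t j \<in> spins"
  shows "patch G W t \<in> sigma_config G W \<rightarrow>\<^sub>M config_space G"
  using measurable_compose [OF restrict_measurable_sigma_config [OF assms(1)]
      patch_measurable_config_space [where t = t, OF assms]]
  by (simp add: patch_restrict)

text \<open>A section of the restriction map; composing with it turns a function that depends on the
  spins in \<open>W\<close> only into a function on the configurations on \<open>W\<close>.\<close>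

lemma patch_measurable_section:
  assumes "W \<subseteq> G" "\<And>j. j \<in> G \<Longrightarrow> t j \<in> spins"
  shows "patch G W t \<in> config_space W \<rightarrow>\<^sub>M sigma_config G W"
  unfolding sigma_config_def
proof (rule measurable_vimage_algebra2)
  show "patch G W t \<in> space (config_space W) \<rightarrow> config G"
    using assms by (auto simp: space_config_space intro!: patch_in_config dest: in_configD)
  have "restrict (patch G W t x) W = x" if "x \<in> space (config_space W)" for x
    using that assms
    by (auto simp: restrict_patch space_config_space config_def PiE_iff extensional_def fun_eq_iff)
  then show "(\<lambda>x. restrict (patch G W t x) W) \<in> config_space W \<rightarrow>\<^sub>M config_space W"
    by (simp cong: measurable_cong)
qed

text \<open>The level set of \<open>h\<close> through \<open>x\<close> is the preimage of a set of configurations on \<open>W\<close>, so it contains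
  \<open>y\<close> as soon as it contains \<open>x\<close>.\<close>

lemma sigma_config_measurable_cong:
  fixes h :: "('g \<Rightarrow> int) \<Rightarrow> real"
  assumes h: "h \<in> borel_measurable (sigma_config G W)" and "W \<subseteq> G"
    and x: "x \<in> config G" and y: "y \<in> config G" and eq: "restrict x W = restrict y W"
  shows "h x = h y"
proof -
  have "h -` {h x} \<inter> config G \<in> sets (sigma_config G W)"
    using measurable_sets [OF h, of "{h x}"] by simp
  then obtain B where "h -` {h x} \<inter> config G = (\<lambda>x. restrict x W) -` B \<inter> config G"
    unfolding sigma_config_def
    by (subst (asm) sets_vimage_algebra2) (auto simp: space_config_space restrict_config \<open>W \<subseteq> G\<close>)
  then have "(z \<in> config G \<and> h z = h x) \<longleftrightarrow> (z \<in> config G \<and> restrict z W \<in> B)" for z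
    by blast
  then show ?thesis
    using x y eq by metis
qed

lemma spin_event_sigma_config:
  assumes "W \<subseteq> G" "j \<in> W" "b \<in> spins"
  shows "{y \<in> config G. y j = b} \<in> sets (sigma_config G W)"
proof -
  have "(\<lambda>x. restrict x W j) \<in> sigma_config G W \<rightarrow>\<^sub>M count_space spins"
    using restrict_measurable_sigma_config [OF assms(1)]
    by (rule measurable_compose) (use assms in \<open>simp add: config_space_def\<close>)
  then have "(\<lambda>x. restrict x W j) -` {b} \<inter> space (sigma_config G W) \<in> sets (sigma_config G W)"
    by (rule measurable_sets) (use assms in simp)
  also have "(\<lambda>x. restrict x W j) -` {b} \<inter> space (sigma_config G W) = {y \<in> config G. y j = b}"
    using assms by auto
  finally show ?thesis .
qed

lemma cylinder_sigma_config:
  assumes "finite W" "W \<subseteq> G" "x \<in> config G"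
  shows "{y \<in> config G. \<forall>j\<in>W. y j = x j} \<in> sets (sigma_config G W)"
proof -
  have "{y \<in> space (sigma_config G W). \<forall>j\<in>W. y j = x j} \<in> sets (sigma_config G W)"
    using assms
    by (intro sets.sets_Collect_finite_All) (auto intro!: spin_event_sigma_config dest: in_configD)
  then show ?thesis by simp
qed

lemma spin_kernel_exists:
  fixes k :: "'b \<Rightarrow> real"
  assumes [measurable]: "k \<in> borel_measurable M" and k: "\<And>z. 0 \<le> k z" "\<And>z. k z \<le> 1"
  shows "\<exists>K \<in> M \<rightarrow>\<^sub>M prob_algebra (count_space spins).
    \<forall>z. measure (K z) {1} = k z \<and> measure (K z) {-1} = 1 - k z"
proof (intro bexI allI)
  define p where "p z a = (if a = 1 then k z else 1 - k z)" for z and a :: int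
  define K where "K z = point_measure spins (\<lambda>a. ennreal (p z a))" for z
  have sets_K: "sets (K z) = sets (count_space spins)" for z
    by (simp add: K_def sets_point_measure)
  have p: "0 \<le> p z a" for z a
    using k by (simp add: p_def)
  have emeasure_K: "emeasure (K z) A = (\<Sum>a\<in>A. ennreal (p z a))" if "A \<subseteq> spins" for z A
    using that by (simp add: K_def emeasure_point_measure_finite)
  have prob: "prob_space (K z)" for z
  proof (rule prob_spaceI)
    have "(\<Sum>a\<in>spins. ennreal (p z a)) = ennreal (\<Sum>a\<in>spins. p z a)"
      by (simp add: p)
    also have "\<dots> = 1"
      by (simp add: p_def spins_def)
    finally show "emeasure (K z) (space (K z)) = 1"
      using sets_eq_imp_space_eq [OF sets_K [of z]] by (simp add: emeasure_K)
  qed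
  show "K \<in> M \<rightarrow>\<^sub>M prob_algebra (count_space spins)"
  proof (rule measurable_prob_algebraI [OF prob measurable_subprob_algebra])
    show "subprob_space (K z)" for z
      by (rule prob_space_imp_subprob_space [OF prob])
    show "(\<lambda>z. emeasure (K z) A) \<in> borel_measurable M" if "A \<in> sets (count_space spins)" for A
      using that by (simp add: emeasure_K p_def)
  qed (rule sets_K)
  show "measure (K z) {1} = k z \<and> measure (K z) {-1} = 1 - k z" for z
    using k by (simp add: measure_def emeasure_K p_def spins_def)
qed

locale random_configuration = prob_space P for P :: "('g \<Rightarrow> int) measure" +
  fixes G :: "'g set"
  assumes sets_P: "sets P = sets (config_space G)"
begin

lemma space_P: "space P = config G"
  using sets_eq_imp_space_eq [OF sets_P] by (simp add: space_config_space)

lemma borel_measurable_P: "borel_measurable P = borel_measurable (config_space G)"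
  by (rule measurable_cong_sets) (simp_all add: sets_P)

lemma subalgebra_sigma_config:
  assumes "W \<subseteq> G"
  shows "subalgebra P (sigma_config G W)"
  unfolding subalgebra_def
proof
  show "sets (sigma_config G W) \<subseteq> sets P"
    unfolding sigma_config_def
  proof (rule sets_image_in_sets [OF space_P])
    show "(\<lambda>x. restrict x W) \<in> P \<rightarrow>\<^sub>M config_space W"
      using restrict_measurable_config_space [OF assms]
      by (subst measurable_cong_sets [OF sets_P refl])
  qed
qed (simp add: space_P)

lemma sets_sigma_config_P: "W \<subseteq> G \<Longrightarrow> A \<in> sets (sigma_config G W) \<Longrightarrow> A \<in> sets P"
  using subalgebra_sigma_config by (auto simp: subalgebra_def)

lemma measurable_sigma_config_P:
  "W \<subseteq> G \<Longrightarrow> h \<in> sigma_config G W \<rightarrow>\<^sub>M N \<Longrightarrow> h \<in> P \<rightarrow>\<^sub>M N"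
  by (rule measurable_from_subalg [OF subalgebra_sigma_config])

lemma sigma_finite_sigma_config: "W \<subseteq> G \<Longrightarrow> sigma_finite_subalgebra P (sigma_config G W)"
  by (intro finite_measure_subalgebra_is_sigma_finite finite_measure_subalgebra.intro
      finite_measure_subalgebra_axioms.intro subalgebra_sigma_config finite_measure_axioms)

lemma spin_event: "j \<in> G \<Longrightarrow> b \<in> spins \<Longrightarrow> {y \<in> config G. y j = b} \<in> sets P"
  by (rule sets_sigma_config_P [OF subset_refl spin_event_sigma_config [OF subset_refl]])

lemma integrable_unit_bounded:
  fixes h :: "('g \<Rightarrow> int) \<Rightarrow> real"
  assumes "h \<in> borel_measurable P" "\<And>x. x \<in> config G \<Longrightarrow> 0 \<le> h x" "\<And>x. x \<in> config G \<Longrightarrow> h x \<le> 1"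
  shows "integrable P h"
  using assms by (intro integrable_const_bound [of _ 1]) (auto simp: space_P)

lemma set_integrable_P:
  fixes h :: "('g \<Rightarrow> int) \<Rightarrow> real"
  shows "integrable P h \<Longrightarrow> A \<in> sets P \<Longrightarrow> set_integrable P A h"
  unfolding set_integrable_def by (rule integrable_mult_indicator)

lemma set_integral_constant: "A \<in> sets P \<Longrightarrow> (LINT x:A|P. (c::real)) = c * prob A"
  by (subst set_integral_const) (auto simp: emeasure_eq_measure)

lemma set_integral_indicator:
  assumes "A \<in> sets P" "B \<in> sets P"
  shows "(LINT x:A|P. indicator B x) = prob (A \<inter> B)"
proof -
  have "(LINT x:A|P. (indicator B x :: real)) = (LINT x|P. indicator (A \<inter> B) x)"
    by (simp add: set_lebesgue_integral_def indicator_inter_arith)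
  then show ?thesis
    using assms by simp
qed

lemma kernel_measurable:
  assumes "regular_version G P i V K" "V \<subseteq> G" "a \<in> spins"
  shows "(\<lambda>z. measure (K z) {a}) \<in> borel_measurable (config_space (V - {i}))"
    and "(\<lambda>x. measure (K (restrict x (V - {i}))) {a}) \<in> borel_measurable (sigma_config G (V - {i}))"
proof -
  have "K \<in> config_space (V - {i}) \<rightarrow>\<^sub>M prob_algebra (count_space spins)"
    using assms by (simp add: regular_version_def)
  then show *: "(\<lambda>z. measure (K z) {a}) \<in> borel_measurable (config_space (V - {i}))"
    by (rule measurable_compose [OF _ measurable_measure_prob_algebra]) (use assms in simp)
  show "(\<lambda>x. measure (K (restrict x (V - {i}))) {a}) \<in> borel_measurable (sigma_config G (V - {i}))"
    using measurable_compose [OF restrict_measurable_sigma_config *] assms by blast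
qed

lemma kernel_prob:
  assumes "regular_version G P i V K" "V \<subseteq> G" "x \<in> config G"
  shows "prob_space (K (restrict x (V - {i})))"
    and "sets (K (restrict x (V - {i}))) = sets (count_space spins)"
proof -
  have "K \<in> config_space (V - {i}) \<rightarrow>\<^sub>M prob_algebra (count_space spins)"
    using assms by (simp add: regular_version_def)
  moreover have "restrict x (V - {i}) \<in> space (config_space (V - {i}))"
    using assms by (auto simp: space_config_space intro!: restrict_config)
  ultimately have "K (restrict x (V - {i})) \<in> space (prob_algebra (count_space spins))"
    by (rule measurable_space)
  then show "prob_space (K (restrict x (V - {i})))"
    and "sets (K (restrict x (V - {i}))) = sets (count_space spins)"
    by (auto simp: space_prob_algebra)
qed

lemma kernel_minus:
  assumes "regular_version G P i V K" "V \<subseteq> G" "x \<in> config G" "a \<in> spins"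
  shows "measure (K (restrict x (V - {i}))) {- a} = 1 - measure (K (restrict x (V - {i}))) {a}"
proof -
  let ?M = "K (restrict x (V - {i}))"
  interpret K: prob_space ?M
    by (rule kernel_prob(1) [OF assms(1-3)])
  have sets_K: "sets ?M = sets (count_space spins)"
    by (rule kernel_prob(2) [OF assms(1-3)])
  have "spins - {a} = {- a}"
    using assms(4) by (auto simp: spins_def)
  moreover have "space ?M = spins"
    using sets_eq_imp_space_eq [OF sets_K] by simp
  moreover have "{a} \<in> sets ?M"
    unfolding sets_K using assms(4) by simp
  ultimately show ?thesis
    using K.prob_compl [of "{a}"] by simp
qed

text \<open>The defining property of the conditional expectation, freed from almost sure statements: integrals
  do not see the null set where the version and the conditional expectation differ.\<close>

lemma version_integral:
  assumes K: "regular_version G P i V K" and "i \<in> G" "V \<subseteq> G" "a \<in> spins"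
    and A: "A \<in> sets (sigma_config G (V - {i}))"
  shows "(LINT x:A|P. measure (K (restrict x (V - {i}))) {a}) = prob (A \<inter> {y \<in> config G. y i = a})"
proof -
  let ?F = "sigma_config G (V - {i})" and ?E = "{y \<in> config G. y i = a}"
  have sub: "V - {i} \<subseteq> G" using assms by auto
  interpret F: sigma_finite_subalgebra P ?F
    by (rule sigma_finite_sigma_config [OF sub])
  have E: "?E \<in> sets P" using assms by (intro spin_event)
  then have int: "integrable P (indicator ?E :: _ \<Rightarrow> real)"
    by (simp add: emeasure_eq_measure)
  have AP: "A \<in> sets P" by (rule sets_sigma_config_P [OF sub A])
  have "(LINT x:A|P. measure (K (restrict x (V - {i}))) {a}) =
      (LINT x:A|P. real_cond_exp P ?F (indicator ?E) x)"
    using K \<open>a \<in> spins\<close> AP measurable_sigma_config_P [OF sub kernel_measurable(2) [OF K assms(3,4)]]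
    by (intro set_lebesgue_integral_cong_AE) (auto simp: regular_version_def)
  also have "\<dots> = (LINT x:A|P. indicator ?E x)"
    by (rule F.real_cond_exp_intA [OF int A, symmetric])
  also have "\<dots> = prob (A \<inter> ?E)"
    by (rule set_integral_indicator [OF AP E])
  finally show ?thesis .
qed

text \<open>A kernel on two spins is determined by the probability \<open>k\<close> of the value \<open>1\<close>. The condition at the
  value \<open>-1\<close> follows by linearity of the conditional expectation.\<close>

lemma regular_version_exists:
  assumes "i \<in> G" "V \<subseteq> G"
    and k: "k \<in> borel_measurable (config_space (V - {i}))" "\<And>z. 0 \<le> k z" "\<And>z. k z \<le> 1"
    and AE_k: "AE x in P. k (restrict x (V - {i})) =
      real_cond_exp P (sigma_config G (V - {i})) (indicator {y \<in> config G. y i = 1}) x"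
  shows "\<exists>K. regular_version G P i V K \<and>
    (\<forall>z. measure (K z) {1} = k z \<and> measure (K z) {-1} = 1 - k z)"
proof -
  let ?F = "sigma_config G (V - {i})"
  let ?E = "\<lambda>a. {y \<in> config G. y i = a}"
  have sub: "V - {i} \<subseteq> G" using assms(2) by blast
  interpret F: sigma_finite_subalgebra P ?F
    by (rule sigma_finite_sigma_config [OF sub])
  obtain K where K: "K \<in> config_space (V - {i}) \<rightarrow>\<^sub>M prob_algebra (count_space spins)"
      "\<And>z. measure (K z) {1} = k z" "\<And>z. measure (K z) {-1} = 1 - k z"
    using spin_kernel_exists [OF k] by blast
  have E: "?E a \<in> sets P" if "a \<in> spins" for a
    using assms(1) that by (rule spin_event)
  have int: "integrable P (indicator (?E 1) :: _ \<Rightarrow> real)"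
    using E [of 1] by (simp add: emeasure_eq_measure)
  have meas: "(indicator (?E (-1)) :: _ \<Rightarrow> real) \<in> borel_measurable P"
    using E [of "-1"] by simp
  have "AE x in P. indicator (?E (-1)) x = 1 - (indicator (?E 1) x :: real)"
  proof (rule AE_I2)
    fix x assume "x \<in> space P"
    then have "x \<in> config G" "x i \<in> spins"
      using assms(1) by (auto simp: space_P dest: in_configD)
    then show "indicator (?E (-1)) x = 1 - (indicator (?E 1) x :: real)"
      by (auto simp: spins_def indicator_def)
  qed
  then have "AE x in P. real_cond_exp P ?F (indicator (?E (-1))) x =
      real_cond_exp P ?F (\<lambda>x. 1 - indicator (?E 1) x) x"
    by (rule F.real_cond_exp_cong) (use int meas in auto)
  moreover have "AE x in P. real_cond_exp P ?F (\<lambda>x. 1 - indicator (?E 1) x) x =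
      real_cond_exp P ?F (\<lambda>x. 1) x - real_cond_exp P ?F (indicator (?E 1)) x"
    by (rule F.real_cond_exp_diff) (use int in auto)
  moreover have "AE x in P. real_cond_exp P ?F (\<lambda>x. 1) x = 1"
    by (rule F.real_cond_exp_F_meas) auto
  ultimately have "AE x in P. 1 - k (restrict x (V - {i})) = real_cond_exp P ?F (indicator (?E (-1))) x"
    using AE_k by eventually_elim simp
  then have "regular_version G P i V K"
    using K AE_k by (auto simp: regular_version_def spins_def)
  with K show ?thesis by blast
qed

end

section \<open>Conditional spin probabilities of an Ising model\<close>

lemma sup_norm_upper:
  assumes "\<And>x. x \<in> config G \<Longrightarrow> \<bar>h x\<bar> \<le> 1" "x \<in> config G"
  shows "\<bar>h x\<bar> \<le> sup_norm G h"
  unfolding sup_norm_def using assms by (intro cSUP_upper) (auto intro!: bdd_aboveI2)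

lemma sup_norm_least:
  assumes "\<And>x. x \<in> config G \<Longrightarrow> \<bar>h x\<bar> \<le> c"
  shows "sup_norm G h \<le> c"
  unfolding sup_norm_def using assms config_nonempty by (intro cSUP_least)

locale ising_field = bounded_potential G f r for G :: "'g set" and f r +
  fixes P :: "('g \<Rightarrow> int) measure"
  assumes ising: "ising_model G f P"

sublocale ising_field \<subseteq> random_configuration P G
  using ising by (auto simp: ising_model_def intro!: random_configuration.intro
      random_configuration_axioms.intro)

context ising_field
begin

definition spin_prob :: "'g \<Rightarrow> int \<Rightarrow> ('g \<Rightarrow> int) \<Rightarrow> real" where
  "spin_prob i a x = logistic (gap G f i a x)"

lemma spin_prob_pos: "0 < spin_prob i a x"
  and spin_prob_le_1: "spin_prob i a x \<le> 1"
  by (simp_all add: spin_prob_def logistic_pos logistic_le_1)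

lemma spin_prob_minus: "spin_prob i (- a) x = 1 - spin_prob i a x"
  by (simp add: spin_prob_def gap_minus logistic_minus)

lemma spin_prob_ge:
  assumes "i \<in> G" "a \<in> spins" "x \<in> config G"
  shows "logistic (- (2 * r)) \<le> spin_prob i a x"
  unfolding spin_prob_def using abs_gap_le [OF assms] by (intro logistic_mono) linarith

lemma ising_prob_eq: "i \<in> G \<Longrightarrow> x \<in> config G \<Longrightarrow> ising_prob G f i x = spin_prob i (x i) x"
  by (simp add: spin_prob_def ising_prob_eq_logistic)

lemma ising_prob_update:
  assumes "i \<in> G" "a \<in> spins" "x \<in> config G"
  shows "ising_prob G f i (x(i := a)) = spin_prob i a x"
  using assms by (simp add: ising_prob_eq config_update spin_prob_def gap_update)

lemma spin_prob_le_best: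
  "i \<in> G \<Longrightarrow> a \<in> spins \<Longrightarrow> x \<in> config G \<Longrightarrow> spin_prob i a x \<le> spin_prob i a (best i W a x)"
  by (simp add: spin_prob_def logistic_mono gap_le_best)

text \<open>Evaluating the Ising formula at \<open>x(i := a)\<close> recovers the whole kernel, because neither the
  condition nor the gap involves the spin at \<open>i\<close>.\<close>

lemma ising_kernel_value:
  assumes "i \<in> G" "a \<in> spins" "x \<in> config G"
    and "\<And>x. x \<in> config G \<Longrightarrow> cond_spin i G K x = ising_prob G f i x"
  shows "measure (K (restrict x (G - {i}))) {a} = spin_prob i a x"
proof -
  have "restrict (x(i := a)) (G - {i}) = restrict x (G - {i})"
    by (auto simp: restrict_def)
  then show ?thesis
    using assms(4) [OF config_update [OF assms(3,1,2)]] ising_prob_update [OF assms(1-3)]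
    by (simp add: cond_spin_def)
qed

lemma ising_kernel_exists:
  assumes "i \<in> G"
  obtains K where "regular_version G P i G K"
    "\<And>x a. x \<in> config G \<Longrightarrow> a \<in> spins \<Longrightarrow> measure (K (restrict x (G - {i}))) {a} = spin_prob i a x"
  using ising assms ising_kernel_value unfolding ising_model_def by metis

text \<open>The gap is a sum over possibly uncountably many sites, so its measurability is not immediate. It
  is inherited from the kernel whose values the Ising formula describes.\<close>

lemma spin_prob_measurable:
  assumes "i \<in> G" "a \<in> spins"
  shows "spin_prob i a \<in> borel_measurable (config_space G)"
proof -
  obtain K where K: "regular_version G P i G K"
    "\<And>x a. x \<in> config G \<Longrightarrow> a \<in> spins \<Longrightarrow> measure (K (restrict x (G - {i}))) {a} = spin_prob i a x"
    using ising_kernel_exists [OF assms(1)] by blast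
  have "(\<lambda>x. measure (K (restrict x (G - {i}))) {a}) \<in> borel_measurable (config_space G)"
    using restrict_measurable_config_space kernel_measurable(1) [OF K(1) subset_refl assms(2)]
    by (rule measurable_compose) auto
  then show ?thesis
    by (rule measurable_cong [THEN iffD1, rotated]) (simp add: space_config_space K(2) assms)
qed

lemma spin_prob_integrable:
  assumes "i \<in> G" "a \<in> spins"
  shows "integrable P (spin_prob i a)"
  using spin_prob_measurable [OF assms] spin_prob_pos spin_prob_le_1
  by (intro integrable_unit_bounded) (auto simp: borel_measurable_P less_imp_le)

text \<open>Averages of \<open>spin_prob\<close> over an event that only involves spins in \<open>W\<close> are actual probabilities,
  although \<open>spin_prob\<close> conditions on all the other spins: this is the tower property.\<close>

lemma spin_prob_integral:
  assumes "i \<in> G" "a \<in> spins" "W \<subseteq> G - {i}" "A \<in> sets (sigma_config G W)"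
  shows "(LINT x:A|P. spin_prob i a x) = prob (A \<inter> {y \<in> config G. y i = a})"
proof -
  obtain K where K: "regular_version G P i G K"
    "\<And>x a. x \<in> config G \<Longrightarrow> a \<in> spins \<Longrightarrow> measure (K (restrict x (G - {i}))) {a} = spin_prob i a x"
    using ising_kernel_exists [OF assms(1)] by blast
  have A: "A \<in> sets (sigma_config G (G - {i}))"
    using sigma_config_mono [OF assms(3)] assms(4) by blast
  then have "A \<subseteq> config G"
    using sets.sets_into_space by fastforce
  have "(LINT x:A|P. spin_prob i a x) = (LINT x:A|P. measure (K (restrict x (G - {i}))) {a})"
  proof (rule set_lebesgue_integral_cong)
    show "A \<in> sets P"
      using A by (rule sets_sigma_config_P [rotated]) blast
    show "\<forall>x. x \<in> A \<longrightarrow> spin_prob i a x = measure (K (restrict x (G - {i}))) {a}"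
      using K(2) assms(2) \<open>A \<subseteq> config G\<close> by (metis subsetD)
  qed
  also have "\<dots> = prob (A \<inter> {y \<in> config G. y i = a})"
    by (rule version_integral [OF K(1) assms(1) subset_refl assms(2) A])
  finally show ?thesis .
qed

text \<open>Whatever is known about the other spins, the spin at \<open>j\<close> takes each value with conditional
  probability at least \<open>logistic (- 2 * r)\<close>, because \<open>spin_prob\<close> is never smaller.\<close>

lemma finite_energy:
  assumes "j \<in> G" "b \<in> spins" "W \<subseteq> G - {j}" "A \<in> sets (sigma_config G W)"
  shows "logistic (- (2 * r)) * prob A \<le> prob (A \<inter> {y \<in> config G. y j = b})"
proof -
  have A: "A \<in> sets P"
    using assms(3) by (intro sets_sigma_config_P [OF _ assms(4)]) blast
  have "A \<subseteq> config G"
    using sets.sets_into_space [OF assms(4)] by simp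
  have "logistic (- (2 * r)) * prob A = (LINT x:A|P. logistic (- (2 * r)))"
    by (simp add: set_integral_constant [OF A])
  also have "\<dots> \<le> (LINT x:A|P. spin_prob j b x)"
    using A assms(1,2) \<open>A \<subseteq> config G\<close>
    by (intro set_integral_mono set_integrable_P spin_prob_integrable spin_prob_ge) auto
  finally show ?thesis
    by (simp add: spin_prob_integral [OF assms])
qed

definition cylinder :: "'g set \<Rightarrow> ('g \<Rightarrow> int) \<Rightarrow> ('g \<Rightarrow> int) set" where
  "cylinder W x = {y \<in> config G. \<forall>j\<in>W. y j = x j}"

lemma cylinder_sets:
  "finite W \<Longrightarrow> W \<subseteq> G \<Longrightarrow> x \<in> config G \<Longrightarrow> cylinder W x \<in> sets (sigma_config G W)"
  unfolding cylinder_def by (rule cylinder_sigma_config)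

lemma cylinder_prob_pos:
  assumes "finite W" "W \<subseteq> G" "x \<in> config G"
  shows "0 < prob (cylinder W x)"
  using assms
proof (induction W)
  case empty
  then show ?case
    using prob_space by (simp add: cylinder_def space_P)
next
  case (insert j W)
  then have "x j \<in> spins"
    by (auto dest: in_configD)
  have "0 < logistic (- (2 * r)) * prob (cylinder W x)"
    using insert by (simp add: logistic_pos)
  also have "\<dots> \<le> prob (cylinder W x \<inter> {y \<in> config G. y j = x j})"
    by (rule finite_energy [of _ _ W]) (use insert \<open>x j \<in> spins\<close> in \<open>auto intro: cylinder_sets\<close>)
  also have "cylinder W x \<inter> {y \<in> config G. y j = x j} = cylinder (insert j W) x"
    by (auto simp: cylinder_def)
  finally show ?case .
qed

text \<open>Cylinders over finitely many sites have positive probability, so for finite \<open>V\<close> a version is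
  determined at every configuration, as an average of \<open>spin_prob\<close>.\<close>

lemma version_on_cylinder:
  assumes K: "regular_version G P i V K" and "i \<in> G" "V \<subseteq> G" "finite V" "x \<in> config G" "a \<in> spins"
  defines "C \<equiv> cylinder (V - {i}) x"
  shows "measure (K (restrict x (V - {i}))) {a} * prob C = (LINT y:C|P. spin_prob i a y)"
proof -
  have C: "C \<in> sets (sigma_config G (V - {i}))"
    unfolding C_def using assms by (intro cylinder_sets) auto
  have CP: "C \<in> sets P"
    by (rule sets_sigma_config_P [OF _ C]) (use assms(3) in blast)
  have "measure (K (restrict x (V - {i}))) {a} * prob C =
      (LINT y:C|P. measure (K (restrict x (V - {i}))) {a})"
    by (rule set_integral_constant [OF CP, symmetric])
  also have "\<dots> = (LINT y:C|P. measure (K (restrict y (V - {i}))) {a})"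
  proof (rule set_lebesgue_integral_cong [OF CP], intro allI impI)
    fix y assume "y \<in> C"
    then have "restrict x (V - {i}) = restrict y (V - {i})"
      by (auto simp: C_def cylinder_def restrict_def fun_eq_iff)
    then show "measure (K (restrict x (V - {i}))) {a} = measure (K (restrict y (V - {i}))) {a}"
      by simp
  qed
  also have "\<dots> = prob (C \<inter> {y \<in> config G. y i = a})"
    by (rule version_integral [OF K assms(2,3,6) C])
  also have "\<dots> = (LINT y:C|P. spin_prob i a y)"
    by (rule spin_prob_integral [symmetric, OF assms(2,6) _ C]) (use assms(3) in blast)
  finally show ?thesis .
qed

text \<open>On the cylinder \<open>C\<close> of configurations that agree with \<open>x\<close>, the version \<open>k\<close> is the average of
  \<open>spin_prob\<close>, and \<open>u\<close> is its largest value. For a finite set \<open>F\<close> of sites outside \<open>W\<close>, the deficit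
  \<open>u - spin_prob i a y\<close> is at least \<open>p\<^sup>2\<close> (a lower bound for the slope of the logistic function on the
  range of the gap) times the sum of \<open>\<omega> i j\<close> over the sites \<open>j\<close> in \<open>F\<close> where \<open>y\<close> is unfavourable, and
  each site in \<open>F\<close> is unfavourable with conditional probability at least \<open>p\<close>. Working with finite \<open>F\<close> avoids exchanging the integral with
  a sum over an arbitrary set of sites.\<close>

lemma version_le_best_minus:
  assumes K: "regular_version G P i V K" and "i \<in> G" "V \<subseteq> G" "finite V" "x \<in> config G" "a \<in> spins"
  shows "measure (K (restrict x (V - {i}))) {a} \<le>
    spin_prob i a (best i (V - {i}) a x)
      - (logistic (- (2 * r)))^3 * (\<Sum>\<^sub>\<infinity>j\<in>G - V. omega f i j)"
proof -
  define W where "W = V - {i}"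
  define C where "C = cylinder W x"
  define p where "p = logistic (- (2 * r))"
  define k where "k = measure (K (restrict x W)) {a}"
  define u where "u = spin_prob i a (best i W a x)"
  have p: "0 < p" by (simp add: p_def logistic_pos)
  have W: "W \<subseteq> G" "finite W" "W \<subseteq> G - {i}"
    using assms by (auto simp: W_def)
  have C: "C \<in> sets (sigma_config G W)"
    unfolding C_def using W assms by (intro cylinder_sets) auto
  have CP: "C \<in> sets P"
    by (rule sets_sigma_config_P [OF W(1) C])
  have "0 < prob C"
    unfolding C_def using W assms by (intro cylinder_prob_pos)
  have k: "k * prob C = (LINT y:C|P. spin_prob i a y)"
    unfolding k_def C_def W_def by (rule version_on_cylinder [OF assms])
  have "p^3 * (\<Sum>j\<in>F. omega f i j) \<le> u - k" if F: "finite F" "F \<subseteq> G - W" for F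
  proof -
    define B where "B j = {y \<in> config G. y j = - favourable f i a j}" for j
    have B: "B j \<in> sets P" if "j \<in> F" for j
      unfolding B_def using F that assms by (intro spin_event) auto
    have intB: "set_integrable P C (\<lambda>y. p\<^sup>2 * (omega f i j * indicator (B j) y))" if "j \<in> F" for j
      using B [OF that] CP by (intro set_integrable_P) (auto simp: emeasure_eq_measure)
    have "p^3 * (\<Sum>j\<in>F. omega f i j) * prob C = (\<Sum>j\<in>F. p\<^sup>2 * (omega f i j * (p * prob C)))"
      by (simp add: sum_distrib_left sum_distrib_right power3_eq_cube power2_eq_square mult_ac)
    also have "\<dots> \<le> (\<Sum>j\<in>F. p\<^sup>2 * (omega f i j * prob (C \<inter> B j)))"
    proof (intro sum_mono mult_left_mono omega_nonneg)
      fix j assume "j \<in> F"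
      then show "p * prob C \<le> prob (C \<inter> B j)"
        unfolding p_def B_def using F W assms by (intro finite_energy [OF _ _ _ C]) auto
    qed simp
    also have "\<dots> = (\<Sum>j\<in>F. LINT y:C|P. p\<^sup>2 * (omega f i j * indicator (B j) y))"
      using B CP by (intro sum.cong) (simp_all add: set_integral_indicator)
    also have "\<dots> = (LINT y:C|P. \<Sum>j\<in>F. p\<^sup>2 * (omega f i j * indicator (B j) y))"
      using intB unfolding set_integrable_def set_lebesgue_integral_def
      by (simp only: scaleR_sum_right Bochner_Integration.integral_sum)
    also have "\<dots> \<le> (LINT y:C|P. u - spin_prob i a y)"
    proof (rule set_integral_mono)
      show "set_integrable P C (\<lambda>y. \<Sum>j\<in>F. p\<^sup>2 * (omega f i j * indicator (B j) y))"
        using intB unfolding set_integrable_def scaleR_sum_right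
        by (rule Bochner_Integration.integrable_sum)
      show "set_integrable P C (\<lambda>y. u - spin_prob i a y)"
        using assms CP by (intro set_integrable_P Bochner_Integration.integrable_diff
            spin_prob_integrable) auto
      fix y assume "y \<in> C"
      then have y: "y \<in> config G" "best i W a x = best i W a y"
        by (auto simp: C_def cylinder_def best_def patch_def fun_eq_iff)
      have "(\<Sum>j\<in>F. p\<^sup>2 * (omega f i j * indicator (B j) y)) =
          p\<^sup>2 * (\<Sum>j\<in>F. omega f i j * of_bool (y j = - favourable f i a j))"
        using y by (simp add: sum_distrib_left B_def indicator_def of_bool_def)
      also have "\<dots> \<le> p\<^sup>2 * (gap G f i a (best i W a y) - gap G f i a y)"
        using y assms F by (intro mult_left_mono gap_best_minus_ge) auto
      also have "\<dots> \<le> u - spin_prob i a y"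
        unfolding p_def u_def spin_prob_def y(2)
        using y assms
        by (intro logistic_diff_ge gap_le_best abs_gap_le best_in_config)
      finally show "(\<Sum>j\<in>F. p\<^sup>2 * (omega f i j * indicator (B j) y)) \<le> u - spin_prob i a y" .
    qed
    also have "\<dots> = (LINT y:C|P. u) - (LINT y:C|P. spin_prob i a y)"
      using assms CP
      by (intro set_integral_diff set_integrable_P spin_prob_integrable) auto
    also have "\<dots> = (u - k) * prob C"
      by (simp add: set_integral_constant [OF CP] left_diff_distrib k)
    finally show ?thesis
      using \<open>0 < prob C\<close> by simp
  qed
  then have "(\<Sum>\<^sub>\<infinity>j\<in>G - W. omega f i j) \<le> (u - k) / p^3"
    using p assms
    by (intro infsum_le_finite_sums omega_summable) (auto simp: field_simps)
  then have "p^3 * (\<Sum>\<^sub>\<infinity>j\<in>G - V. omega f i j) \<le> u - k"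
    using p assms by (simp add: W_def infsum_omega_remove field_simps)
  then show ?thesis
    by (simp add: p_def u_def k_def W_def)
qed

section \<open>A version without exceptional configurations\<close>

text \<open>The conditional expectation of the event \<open>{y. y i = 1}\<close> is that of \<open>spin_prob i 1\<close>, which lies
  between its values at the two extremal configurations. These values depend on the spins in \<open>W\<close> only,
  so they are their own conditional expectations.\<close>

lemma cond_exp_bounds:
  assumes "i \<in> G" "W \<subseteq> G - {i}"
  defines "e \<equiv> real_cond_exp P (sigma_config G W) (indicator {y \<in> config G. y i = 1})"
  shows "AE x in P. spin_prob i 1 (best i W (-1) x) \<le> e x \<and> e x \<le> spin_prob i 1 (best i W 1 x)"
proof -
  let ?F = "sigma_config G W" and ?q = "spin_prob i 1"
  have W: "W \<subseteq> G" using assms(2) by blast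
  interpret F: sigma_finite_subalgebra P ?F
    by (rule sigma_finite_sigma_config [OF W])
  have E: "{y \<in> config G. y i = 1} \<in> sets P"
    using assms(1) by (rule spin_event) simp
  have q: "integrable P ?q"
    using assms(1) by (rule spin_prob_integrable) simp
  have *: "AE x in P. e x = real_cond_exp P ?F ?q x"
    unfolding e_def
  proof (rule F.real_cond_exp_charact)
    fix A assume A: "A \<in> sets ?F"
    have "(LINT x:A|P. indicator {y \<in> config G. y i = 1} x) = (LINT x:A|P. ?q x)"
      using set_integral_indicator [OF sets_sigma_config_P [OF W A] E]
        spin_prob_integral [OF assms(1) one_in_spins assms(2) A] by simp
    also have "\<dots> = (LINT x:A|P. real_cond_exp P ?F ?q x)"
      by (rule F.real_cond_exp_intA [OF q A])
    finally show "(LINT x:A|P. indicator {y \<in> config G. y i = 1} x) =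
      (LINT x:A|P. real_cond_exp P ?F ?q x)" .
  next
    show "integrable P (real_cond_exp P ?F ?q)"
      by (rule F.real_cond_exp_int(1) [OF q])
  qed (use E in \<open>auto simp: emeasure_eq_measure\<close>)
  have b: "AE x in P. real_cond_exp P ?F (\<lambda>x. ?q (best i W a x)) x = ?q (best i W a x)"
    "integrable P (\<lambda>x. ?q (best i W a x))" if a: "a \<in> spins" for a
  proof -
    have m: "(\<lambda>x. ?q (best i W a x)) \<in> borel_measurable ?F"
      unfolding best_def
      by (rule measurable_compose [OF patch_measurable_sigma_config spin_prob_measurable])
        (use W assms(1) a in auto)
    show int: "integrable P (\<lambda>x. ?q (best i W a x))"
      using measurable_sigma_config_P [OF W m] spin_prob_pos spin_prob_le_1
      by (intro integrable_unit_bounded) (auto simp: less_imp_le)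
    show "AE x in P. real_cond_exp P ?F (\<lambda>x. ?q (best i W a x)) x = ?q (best i W a x)"
      by (rule F.real_cond_exp_F_meas [OF int m])
  qed
  have "AE x in P. real_cond_exp P ?F (\<lambda>x. ?q (best i W (-1) x)) x \<le> real_cond_exp P ?F ?q x"
  proof (rule F.real_cond_exp_mono)
    show "AE x in P. ?q (best i W (-1) x) \<le> ?q x"
      using gap_best_minus_le [OF assms(1) one_in_spins]
      by (intro AE_I2) (simp add: space_P spin_prob_def logistic_mono)
  qed (use b q in \<open>auto simp: spins_def\<close>)
  moreover have "AE x in P. real_cond_exp P ?F ?q x \<le> real_cond_exp P ?F (\<lambda>x. ?q (best i W 1 x)) x"
  proof (rule F.real_cond_exp_mono)
    show "AE x in P. ?q x \<le> ?q (best i W 1 x)"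
      using spin_prob_le_best [OF assms(1) one_in_spins]
      by (intro AE_I2) (simp add: space_P)
  qed (use b q in \<open>auto simp: spins_def\<close>)
  moreover have "- 1 \<in> spins" by (simp add: spins_def)
  ultimately show ?thesis
    using * b(1) [OF one_in_spins] b(1) [of "-1"] by (auto elim!: eventually_elim2)
qed

text \<open>The bounds of \<open>cond_exp_bounds\<close> may fail on a null set, so the conditional expectation \<open>e\<close> is
  truncated at them. This changes nothing almost surely, and keeps the function measurable. Only the
  upper bound is stated: for \<open>- a\<close> in place of \<open>a\<close> it is the lower bound for \<open>a\<close>.\<close>

lemma enclosed_version_exists:
  assumes "i \<in> G" "V \<subseteq> G"
  shows "\<exists>K. regular_version G P i V K \<and> (\<forall>x\<in>config G. \<forall>a\<in>spins.
    measure (K (restrict x (V - {i}))) {a} \<le> spin_prob i a (best i (V - {i}) a x))"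
proof -
  define W where "W = V - {i}"
  define e where "e = real_cond_exp P (sigma_config G W) (indicator {y \<in> config G. y i = 1})"
  \<comment> \<open>Composing with the extension \<open>s\<close> makes \<open>e\<close> a function on the configurations on \<open>W\<close>.\<close>
  define s where "s = patch G W (\<lambda>_. 1 :: int)"
  define l where "l x = spin_prob i 1 (best i W (-1) x)" for x
  define u where "u x = spin_prob i 1 (best i W 1 x)" for x
  define k where "k z = max (l z) (min (u z) (e (s z)))" for z
  have W: "W \<subseteq> G" "W \<subseteq> G - {i}"
    using assms by (auto simp: W_def)
  have best_restrict: "best i W a (restrict x W) = best i W a x" for a x
    by (simp add: best_def patch_restrict)
  have meas: "(\<lambda>z. spin_prob i 1 (best i W a z)) \<in> borel_measurable (config_space W)" if "a \<in> spins" for a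
    unfolding best_def
    by (rule measurable_compose [OF patch_measurable_config_space spin_prob_measurable])
      (use W assms(1) that in auto)
  have "e \<in> borel_measurable (sigma_config G W)"
    by (simp add: e_def)
  then have "(\<lambda>z. e (s z)) \<in> borel_measurable (config_space W)"
    unfolding s_def by (rule measurable_compose [rotated]) (use W in \<open>auto intro: patch_measurable_section\<close>)
  then have k: "k \<in> borel_measurable (config_space W)"
    unfolding k_def [abs_def] l_def [abs_def] u_def [abs_def]
    using meas [of 1] meas [of "-1"] by (auto simp: spins_def)
  have e_s: "e (s (restrict x W)) = e x" if "x \<in> config G" for x
  proof (rule sigma_config_measurable_cong [OF \<open>e \<in> borel_measurable (sigma_config G W)\<close> W(1)])
    show "s (restrict x W) \<in> config G"
      unfolding s_def using that W(1) by (intro patch_in_config) (auto dest: in_configD)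
    show "restrict (s (restrict x W)) W = restrict x W"
      using W(1) by (simp add: s_def restrict_patch)
  qed (rule that)
  have l: "l x \<le> u x" if "x \<in> config G" for x
    using gap_best_minus_le [OF assms(1) one_in_spins that, of W]
      gap_le_best [OF assms(1) one_in_spins that, of W]
    by (simp add: l_def u_def spin_prob_def logistic_mono)
  have "AE x in P. l x \<le> e x \<and> e x \<le> u x"
    unfolding l_def u_def e_def by (rule cond_exp_bounds [OF assms(1) W(2)])
  then have "AE x in P. k (restrict x W) = e x"
    using AE_space
    by eventually_elim (simp add: k_def l_def u_def best_restrict e_s space_P)
  moreover have "0 \<le> k z" "k z \<le> 1" for z
    using spin_prob_pos [of i 1 "best i W (-1) z"] spin_prob_le_1 [of i 1 "best i W (-1) z"]
      spin_prob_le_1 [of i 1 "best i W 1 z"]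
    by (auto simp: k_def l_def u_def)
  ultimately obtain K where K: "regular_version G P i V K"
    "\<And>z. measure (K z) {1} = k z" "\<And>z. measure (K z) {-1} = 1 - k z"
    using regular_version_exists [OF assms, of k] k unfolding W_def e_def by blast
  have "measure (K (restrict x W)) {a} \<le> spin_prob i a (best i W a x)"
    if x: "x \<in> config G" and "a \<in> spins" for x a
  proof -
    have "l x \<le> k (restrict x W)" "k (restrict x W) \<le> u x"
      using l [OF x] by (auto simp: k_def l_def u_def best_restrict)
    moreover have "spin_prob i (-1) (best i W (-1) x) = 1 - l x"
      by (simp add: l_def spin_prob_minus [of i 1])
    ultimately show ?thesis
      using \<open>a \<in> spins\<close> by (auto simp: spins_def K u_def)
  qed
  with K(1) show ?thesis
    unfolding W_def by blast
qed

section \<open>Comparison with the neglected interaction\<close>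

lemma cond_spin_bounds:
  assumes "regular_version G P i V K" "V \<subseteq> G" "x \<in> config G"
  shows "0 \<le> cond_spin i V K x" "cond_spin i V K x \<le> 1"
  using prob_space.prob_le_1 [OF kernel_prob(1) [OF assms]] by (simp_all add: cond_spin_def)

lemma cond_diff_bound:
  assumes Q: "ising_versions G f P Q" and "i \<in> G" "V \<subseteq> G" "x \<in> config G"
  shows "\<bar>cond_spin i G (Q i G) x - cond_spin i V (Q i V) x\<bar> \<le> 1"
proof -
  have "regular_version G P i G (Q i G)" "regular_version G P i V (Q i V)"
    using assms by (auto simp: ising_versions_def)
  from cond_spin_bounds [OF this(1) _ assms(4)] cond_spin_bounds [OF this(2) assms(3,4)]
  show ?thesis by auto
qed

text \<open>The configurations \<open>x\<close> and \<open>y\<close> agree on \<open>V\<close> and at \<open>i\<close>, so every version given \<open>V\<close> takes the same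
  value at both; elsewhere they are extremal in opposite directions, which makes the probabilities given
  \<open>G\<close> differ as much as possible. The factor \<open>1 / 2\<close> comes from the triangle inequality.\<close>

lemma omega_le_cond_dist:
  assumes Q: "ising_versions G f P Q" and "i \<in> G" "V \<subseteq> G"
  shows "(logistic (- (2 * r)))\<^sup>2 / 2 * (\<Sum>\<^sub>\<infinity>j\<in>G - V. omega f i j) \<le> cond_dist G Q i V"
proof -
  \<comment> \<open>The values of \<open>z\<close> on \<open>V\<close> are arbitrary; they are common to \<open>x\<close> and \<open>y\<close>.\<close>
  obtain z where z: "z \<in> config G"
    using config_nonempty by blast
  define W where "W = V - {i}"
  define x where "x = (best i W 1 z)(i := 1)"
  define y where "y = (best i W (-1) z)(i := 1)"
  let ?d = "\<lambda>x. cond_spin i G (Q i G) x - cond_spin i V (Q i V) x"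
  have m1: "- 1 \<in> spins" by (simp add: spins_def)
  have best: "best i W 1 z \<in> config G" "best i W (-1) z \<in> config G"
    using z by (simp_all add: best_in_config m1)
  have x: "x \<in> config G" and y: "y \<in> config G"
    unfolding x_def y_def using best assms(2) by (simp_all add: config_update)
  have G: "cond_spin i G (Q i G) x = spin_prob i 1 (best i W 1 z)"
    "cond_spin i G (Q i G) y = spin_prob i 1 (best i W (-1) z)"
    using Q x y best assms(2)
    by (simp_all add: ising_versions_def x_def y_def ising_prob_update)
  have "restrict x W = restrict y W" "x i = y i"
    using assms(3)
    by (auto simp: x_def y_def W_def best_def patch_def restrict_def fun_eq_iff)
  then have V: "cond_spin i V (Q i V) x = cond_spin i V (Q i V) y"
    by (simp add: cond_spin_def W_def)
  have "(logistic (- (2 * r)))\<^sup>2 * (\<Sum>\<^sub>\<infinity>j\<in>G - V. omega f i j) =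
      (logistic (- (2 * r)))\<^sup>2 * (gap G f i 1 (best i W 1 z) - gap G f i 1 (best i W (-1) z))"
    using gap_best_minus_worst [OF assms(2) one_in_spins z, of W] infsum_omega_remove [OF assms(2), of V]
    by (simp add: W_def)
  also have "\<dots> \<le> spin_prob i 1 (best i W 1 z) - spin_prob i 1 (best i W (-1) z)"
    unfolding spin_prob_def
  proof (rule logistic_diff_ge)
    show "gap G f i 1 (best i W (-1) z) \<le> gap G f i 1 (best i W 1 z)"
      using gap_best_minus_le [OF assms(2) one_in_spins z, of W] gap_le_best [OF assms(2) one_in_spins z, of W]
      by simp
  qed (use best assms(2) in \<open>auto intro!: abs_gap_le\<close>)
  also have "\<dots> \<le> \<bar>?d x\<bar> + \<bar>?d y\<bar>"
    using G V by linarith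
  also have "\<dots> \<le> cond_dist G Q i V + cond_dist G Q i V"
    unfolding cond_dist_def
    using x y cond_diff_bound [OF assms] by (intro add_mono sup_norm_upper)
  finally show ?thesis by simp
qed

text \<open>At each configuration, both conditional probabilities lie in the same interval, between the two
  extremal values of \<open>spin_prob\<close>, and its length is at most the neglected interaction.\<close>

lemma cond_dist_le_omega:
  assumes Q: "ising_versions G f P Q" and "i \<in> G" "V \<subseteq> G"
    and le_best: "\<And>x a. x \<in> config G \<Longrightarrow> a \<in> spins \<Longrightarrow>
      measure (Q i V (restrict x (V - {i}))) {a} \<le> spin_prob i a (best i (V - {i}) a x)"
  shows "cond_dist G Q i V \<le> (\<Sum>\<^sub>\<infinity>j\<in>G - V. omega f i j)"
  unfolding cond_dist_def
proof (rule sup_norm_least)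
  fix x assume x: "x \<in> config G"
  define a where "a = x i"
  let ?W = "V - {i}" and ?k = "\<lambda>a. measure (Q i V (restrict x (V - {i}))) {a}"
  have a: "a \<in> spins" and ma: "- a \<in> spins"
    using in_configD [OF x assms(2)] by (simp_all add: a_def)
  have version: "regular_version G P i V (Q i V)"
    using Q assms(2,3) by (simp add: ising_versions_def)
  have "?k a \<le> spin_prob i a (best i ?W a x)"
    by (rule le_best [OF x a])
  moreover have "spin_prob i a (best i ?W (- a) x) \<le> ?k a"
    using le_best [OF x ma] kernel_minus [OF version assms(3) x a]
    by (simp add: spin_prob_minus)
  moreover have "spin_prob i a x \<le> spin_prob i a (best i ?W a x)"
    by (rule spin_prob_le_best [OF assms(2) a x])
  moreover have "spin_prob i a (best i ?W (- a) x) \<le> spin_prob i a x"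
    unfolding spin_prob_def by (intro logistic_mono gap_best_minus_le assms(2) a x)
  moreover have "spin_prob i a (best i ?W a x) - spin_prob i a (best i ?W (- a) x)
      \<le> (\<Sum>\<^sub>\<infinity>j\<in>G - V. omega f i j)"
    using logistic_best_minus_worst [OF assms(2) a x, of ?W] infsum_omega_remove [OF assms(2)]
    by (simp add: spin_prob_def)
  moreover have "cond_spin i G (Q i G) x = spin_prob i a x"
    using Q assms(2) x by (simp add: ising_versions_def ising_prob_eq a_def)
  moreover have "cond_spin i V (Q i V) x = ?k a"
    by (simp add: cond_spin_def a_def)
  ultimately show "\<bar>cond_spin i G (Q i G) x - cond_spin i V (Q i V) x\<bar>
      \<le> (\<Sum>\<^sub>\<infinity>j\<in>G - V. omega f i j)"
    by linarith
qed

lemma cond_dist_finite_le_omega: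
  assumes Q: "ising_versions G f P Q" and "i \<in> G" "V \<subseteq> G" "finite V"
  shows "cond_dist G Q i V \<le> (\<Sum>\<^sub>\<infinity>j\<in>G - V. omega f i j)"
proof (rule cond_dist_le_omega [OF assms(1-3)])
  fix x a assume "x \<in> config G" "a \<in> spins"
  moreover have "regular_version G P i V (Q i V)"
    using Q assms(2,3) by (simp add: ising_versions_def)
  ultimately have "measure (Q i V (restrict x (V - {i}))) {a} \<le> spin_prob i a (best i (V - {i}) a x)
      - (logistic (- (2 * r)))^3 * (\<Sum>\<^sub>\<infinity>j\<in>G - V. omega f i j)"
    using assms by (intro version_le_best_minus)
  moreover have "0 \<le> (logistic (- (2 * r)))^3 * (\<Sum>\<^sub>\<infinity>j\<in>G - V. omega f i j)"
    by (intro mult_nonneg_nonneg infsum_nonneg omega_nonneg) (simp add: logistic_pos less_imp_le)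
  ultimately show "measure (Q i V (restrict x (V - {i}))) {a} \<le> spin_prob i a (best i (V - {i}) a x)"
    by linarith
qed

text \<open>The value that \<open>version_le_best_minus\<close> compares with is itself a conditional probability given
  \<open>G\<close>, attained at the extremal configuration \<open>y\<close>.\<close>

lemma sup_norm_gain:
  assumes Q: "ising_versions G f P Q" and "i \<in> G" "V \<subseteq> G" "finite V"
  shows "(logistic (- (2 * r)))^3 * (\<Sum>\<^sub>\<infinity>j\<in>G - V. omega f i j) \<le>
    sup_norm G (cond_spin i G (Q i G)) - sup_norm G (cond_spin i V (Q i V))"
proof -
  let ?g = "(logistic (- (2 * r)))^3 * (\<Sum>\<^sub>\<infinity>j\<in>G - V. omega f i j)"
  have versions: "regular_version G P i G (Q i G)" "regular_version G P i V (Q i V)"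
    using Q assms(2,3) by (auto simp: ising_versions_def)
  have "sup_norm G (cond_spin i V (Q i V)) \<le> sup_norm G (cond_spin i G (Q i G)) - ?g"
  proof (rule sup_norm_least)
    fix x assume x: "x \<in> config G"
    have xi: "x i \<in> spins"
      by (rule in_configD [OF x assms(2)])
    define y where "y = (best i (V - {i}) (x i) x)(i := x i)"
    have b: "best i (V - {i}) (x i) x \<in> config G"
      by (rule best_in_config [OF xi x])
    have y: "y \<in> config G"
      unfolding y_def by (rule config_update [OF b assms(2) xi])
    have "\<bar>cond_spin i V (Q i V) x\<bar> = measure (Q i V (restrict x (V - {i}))) {x i}"
      by (simp add: cond_spin_def)
    also have "\<dots> \<le> spin_prob i (x i) (best i (V - {i}) (x i) x) - ?g"
      by (rule version_le_best_minus [OF versions(2) assms(2-4) x xi])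
    also have "spin_prob i (x i) (best i (V - {i}) (x i) x) = cond_spin i G (Q i G) y"
      using Q assms(2) y ising_prob_update [OF assms(2) xi b] by (simp add: ising_versions_def y_def)
    also have "\<dots> \<le> sup_norm G (cond_spin i G (Q i G))"
    proof -
      have "\<bar>cond_spin i G (Q i G) z\<bar> \<le> 1" if "z \<in> config G" for z
        using cond_spin_bounds [OF versions(1) subset_refl that] by simp
      from sup_norm_upper [of G "cond_spin i G (Q i G)", OF this y] show ?thesis
        by simp
    qed
    finally show "\<bar>cond_spin i V (Q i V) x\<bar> \<le> sup_norm G (cond_spin i G (Q i G)) - ?g"
      by simp
  qed
  then show ?thesis by simp
qed

text \<open>For \<open>V = G\<close> the version prescribed by the Ising formula is chosen; it satisfies the bounds because
  \<open>spin_prob\<close> itself does.\<close>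

lemma enclosed_versions_exist:
  "\<exists>Q. ising_versions G f P Q \<and>
    (\<forall>i\<in>G. \<forall>V\<subseteq>G. cond_dist G Q i V \<le> (\<Sum>\<^sub>\<infinity>j\<in>G - V. omega f i j))"
proof -
  define good where "good i V K \<longleftrightarrow> regular_version G P i V K \<and> (\<forall>x\<in>config G. \<forall>a\<in>spins.
    measure (K (restrict x (V - {i}))) {a} \<le> spin_prob i a (best i (V - {i}) a x))" for i V K
  have "\<exists>K. good i V K \<and> (V = G \<longrightarrow> (\<forall>x\<in>config G. cond_spin i G K x = ising_prob G f i x))"
    if "i \<in> G" "V \<subseteq> G" for i V
  proof (cases "V = G")
    case True
    obtain K where "regular_version G P i G K" "\<forall>x\<in>config G. cond_spin i G K x = ising_prob G f i x"
      using ising \<open>i \<in> G\<close> by (auto simp: ising_model_def)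
    moreover from this have "good i G K"
      using spin_prob_le_best \<open>i \<in> G\<close> by (simp add: good_def ising_kernel_value)
    ultimately show ?thesis
      using True by blast
  next
    case False
    then show ?thesis
      using enclosed_version_exists [OF that] by (simp add: good_def)
  qed
  then obtain Q where Q: "\<And>i V. i \<in> G \<Longrightarrow> V \<subseteq> G \<Longrightarrow> good i V (Q i V)"
    "\<And>i x. i \<in> G \<Longrightarrow> x \<in> config G \<Longrightarrow> cond_spin i G (Q i G) x = ising_prob G f i x"
    by (metis subset_refl)
  have "ising_versions G f P Q"
    using Q by (simp add: ising_versions_def good_def)
  moreover have "cond_dist G Q i V \<le> (\<Sum>\<^sub>\<infinity>j\<in>G - V. omega f i j)" if "i \<in> G" "V \<subseteq> G" for i V
    using \<open>ising_versions G f P Q\<close> that Q(1) [OF that]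
    by (intro cond_dist_le_omega) (auto simp: good_def)
  ultimately show ?thesis by blast
qed

end

theorem theorem4p5:
  fixes r :: real
  assumes "0 \<le> r"
  shows "\<exists>c C \<kappa>. 0 < c \<and> c \<le> C \<and> 0 < \<kappa> \<and>
    (\<forall>(G :: 'g set) f P.
      pairwise_potential G f \<and> strength G f = ennreal r \<and> ising_model G f P \<longrightarrow>
      (\<exists>Q. ising_versions G f P Q \<and>
        (\<forall>i\<in>G. \<forall>V\<subseteq>G.
          c * (\<Sum>\<^sub>\<infinity>j\<in>G - V. omega f i j) \<le> cond_dist G Q i V \<and>
          cond_dist G Q i V \<le> C * (\<Sum>\<^sub>\<infinity>j\<in>G - V. omega f i j))) \<and>
      (\<forall>Q. ising_versions G f P Q \<longrightarrow>
        (\<forall>i\<in>G. \<forall>V\<subseteq>G.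
          c * (\<Sum>\<^sub>\<infinity>j\<in>G - V. omega f i j) \<le> cond_dist G Q i V \<and>
          (finite V \<longrightarrow>
            cond_dist G Q i V \<le> C * (\<Sum>\<^sub>\<infinity>j\<in>G - V. omega f i j) \<and>
            \<kappa> * cond_dist G Q i V \<le>
              sup_norm G (cond_spin i G (Q i G)) - sup_norm G (cond_spin i V (Q i V))))))"
proof -
  define p where "p = logistic (- (2 * r))"
  have p: "0 < p" "p \<le> 1"
    by (simp_all add: p_def logistic_pos logistic_le_1)
  show ?thesis
  proof (rule exI [of _ "p\<^sup>2 / 2"], rule exI [of _ 1], rule exI [of _ "p^3"],
      intro conjI allI impI)
    show "0 < p\<^sup>2 / 2" "0 < p^3"
      using p by simp_all
    show "p\<^sup>2 / 2 \<le> 1"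
      using p power_le_one [of p 2] by simp
  next
    fix G :: "'g set" and f P
    assume "pairwise_potential G f \<and> strength G f = ennreal r \<and> ising_model G f P"
    then interpret ising_field G f r P
      using assms by unfold_locales auto
    note lower = omega_le_cond_dist [folded p_def]
    show "\<exists>Q. ising_versions G f P Q \<and>
        (\<forall>i\<in>G. \<forall>V\<subseteq>G.
          p\<^sup>2 / 2 * (\<Sum>\<^sub>\<infinity>j\<in>G - V. omega f i j) \<le> cond_dist G Q i V \<and>
          cond_dist G Q i V \<le> 1 * (\<Sum>\<^sub>\<infinity>j\<in>G - V. omega f i j))"
      using enclosed_versions_exist lower by (metis mult_1)
    fix Q
    assume Q: "ising_versions G f P Q"
    show "\<forall>i\<in>G. \<forall>V\<subseteq>G.
          p\<^sup>2 / 2 * (\<Sum>\<^sub>\<infinity>j\<in>G - V. omega f i j) \<le> cond_dist G Q i V \<and>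
          (finite V \<longrightarrow>
            cond_dist G Q i V \<le> 1 * (\<Sum>\<^sub>\<infinity>j\<in>G - V. omega f i j) \<and>
            p^3 * cond_dist G Q i V \<le>
              sup_norm G (cond_spin i G (Q i G)) - sup_norm G (cond_spin i V (Q i V)))"
    proof (intro ballI allI impI conjI)
      fix i V assume i: "i \<in> G" and V: "V \<subseteq> G"
      show "p\<^sup>2 / 2 * (\<Sum>\<^sub>\<infinity>j\<in>G - V. omega f i j) \<le> cond_dist G Q i V"
        by (rule lower [OF Q i V])
      assume "finite V"
      note upper = cond_dist_finite_le_omega [OF Q i V this]
      then show "cond_dist G Q i V \<le> 1 * (\<Sum>\<^sub>\<infinity>j\<in>G - V. omega f i j)"
        by simp
      have "p^3 * cond_dist G Q i V \<le> p^3 * (\<Sum>\<^sub>\<infinity>j\<in>G - V. omega f i j)"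
        using upper p by (intro mult_left_mono) auto
      also have "\<dots> \<le> sup_norm G (cond_spin i G (Q i G)) - sup_norm G (cond_spin i V (Q i V))"
        unfolding p_def by (rule sup_norm_gain [OF Q i V \<open>finite V\<close>])
      finally show "p^3 * cond_dist G Q i V \<le>
          sup_norm G (cond_spin i G (Q i G)) - sup_norm G (cond_spin i V (Q i V))" .
    qed
  qed
qed

end
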